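(* Let $\mu$ be a positive finite Borel measure on $[0,1)$ and let $R_\mu$ be the associated Rhaly operator acting boundedly on the Hardy space $H^2$. For $0<x\le\infty$ let $\widetilde W_x$ be the weighted composition operator on $H^2$ defined by $$\widetilde W_x f(z)=\frac{f(e^{-x}z)}{1-e^{-x}z},$$ where $e^{-\infty}=0$. If $M$ is a closed subspace of $H^2$ invariant under every $\widetilde W_x$, then $M$ is invariant under $R_\mu$.
   Context: $\mathbb{D}$ is the open unit disc and $H^2$ is the Hardy space of holomorphic functions $f(z)=\sum_{k\ge 0}x_kz^k$ on $\mathbb{D}$ with $(x_k)_{k\ge 0}\in\ell^2$, identified isometrically with $\ell^2$ via Taylor coefficients. With $\mu_n=\int_0^1t^n\,d\mu(t)$ (and $0^0=1$), the Rhaly operator $R_\mu$ is given, with respect to the basis $(z^n)_{n\ge 0}$, by the lower triangular matrix whose $(n,k)$ entry is $\mu_n$ for $0\le k\le n$ and $0$ for $k>n$; equivalently $R_\mu f(z)=\int_0^1\frac{f(tz)}{1-tz}\,d\mu(t)$. A subspace $M$ is invariant under $T$ if $TM\subseteq M$. *)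

theory Defs
  imports "HOL-Complex_Analysis.Complex_Analysis" "HOL-Library.Extended_Real"
begin

section \<open>The Hardy space\<close>

definition taylor_coeff :: "(complex \<Rightarrow> complex) \<Rightarrow> nat \<Rightarrow> complex" where
  "taylor_coeff f k = fps_nth (fps_expansion f 0) k"

text \<open>Elements are functions on the open unit disc. The values outside the disc are fixed to
  be \<^term>\<open>0\<close>, so that equality in the type is equality of functions on the disc.\<close>

typedef hardy = "{f :: complex \<Rightarrow> complex.
    f holomorphic_on ball 0 1 \<and>
    summable (\<lambda>k. (cmod (taylor_coeff f k))\<^sup>2) \<and>
    (\<forall>z::complex. z \<notin> ball 0 1 \<longrightarrow> f z = 0)}"
  morphisms hardy_fun Abs_hardy
proof
  have "taylor_coeff (\<lambda>_. 0) k = 0" for k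
    by (simp add: taylor_coeff_def fps_expansion_def)
  then show "(\<lambda>_. 0) \<in> {f. f holomorphic_on ball 0 1 \<and>
      summable (\<lambda>k. (cmod (taylor_coeff f k))\<^sup>2) \<and> (\<forall>z. z \<notin> ball 0 1 \<longrightarrow> f z = 0)}"
    by simp
qed

definition hardy_coeff :: "hardy \<Rightarrow> nat \<Rightarrow> complex" where
  "hardy_coeff f = taylor_coeff (hardy_fun f)"

lemma hardy_fun_holomorphic: "hardy_fun f holomorphic_on ball 0 1"
  using hardy_fun[of f] by simp

lemma hardy_fun_outside: "z \<notin> ball 0 1 \<Longrightarrow> hardy_fun f z = 0"
  using hardy_fun[of f] by simp

lemma summable_hardy_coeff: "summable (\<lambda>k. (cmod (hardy_coeff f k))\<^sup>2)"
  using hardy_fun[of f] by (simp add: hardy_coeff_def)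

lemma taylor_coeff_sums:
  assumes "f holomorphic_on ball 0 r" "cmod z < r"
  shows "(\<lambda>k. taylor_coeff f k * z ^ k) sums f z"
  using holomorphic_power_series[of f 0 r z] assms
  by (simp add: taylor_coeff_def fps_expansion_def)

lemma hardy_fun_sums:
  assumes "cmod z < 1"
  shows "(\<lambda>k. hardy_coeff f k * z ^ k) sums hardy_fun f z"
  unfolding hardy_coeff_def using taylor_coeff_sums[OF hardy_fun_holomorphic assms] .

lemma hardy_eqI:
  assumes "\<And>k. hardy_coeff f k = hardy_coeff g k"
  shows "f = g"
proof -
  have "hardy_fun f z = hardy_fun g z" for z
  proof (cases "cmod z < 1")
    case True
    show ?thesis
      using hardy_fun_sums[OF True, of f] hardy_fun_sums[OF True, of g] assms
      by (auto intro: sums_unique2)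
  next
    case False
    then show ?thesis by (simp add: hardy_fun_outside)
  qed
  then show ?thesis
    by (simp add: hardy_fun_inject[symmetric] fun_eq_iff)
qed

lemma summable_square_add:
  fixes a b :: "nat \<Rightarrow> complex"
  assumes "summable (\<lambda>k. (cmod (a k))\<^sup>2)" "summable (\<lambda>k. (cmod (b k))\<^sup>2)"
  shows "summable (\<lambda>k. (cmod (a k + b k))\<^sup>2)"
proof (rule summable_comparison_test')
  show "summable (\<lambda>k. 2 * ((cmod (a k))\<^sup>2 + (cmod (b k))\<^sup>2))"
    using assms by (intro summable_mult summable_add)
  fix k :: nat
  have "(cmod (a k + b k))\<^sup>2 \<le> (cmod (a k) + cmod (b k))\<^sup>2"
    by (intro power_mono norm_triangle_ineq) auto
  also have "\<dots> \<le> 2 * ((cmod (a k))\<^sup>2 + (cmod (b k))\<^sup>2)"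
    using sum_squares_bound[of "cmod (a k)" "cmod (b k)"] by (simp add: power2_sum)
  finally show "norm ((cmod (a k + b k))\<^sup>2) \<le> 2 * ((cmod (a k))\<^sup>2 + (cmod (b k))\<^sup>2)"
    by simp
qed

lemma summable_square_cmult:
  fixes a :: "nat \<Rightarrow> complex"
  assumes "summable (\<lambda>k. (cmod (a k))\<^sup>2)"
  shows "summable (\<lambda>k. (cmod (c * a k))\<^sup>2)"
  using summable_mult[OF assms, of "(cmod c)\<^sup>2"] by (simp add: norm_mult power_mult_distrib)

lemma taylor_coeff_add:
  "f holomorphic_on ball 0 1 \<Longrightarrow> g holomorphic_on ball 0 1 \<Longrightarrow>
    taylor_coeff (\<lambda>z. f z + g z) k = taylor_coeff f k + taylor_coeff g k"
  using higher_deriv_add[of f "ball 0 1" g 0 k]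
  by (simp add: taylor_coeff_def fps_expansion_def add_divide_distrib)

lemma taylor_coeff_cmult:
  "f holomorphic_on ball 0 1 \<Longrightarrow> taylor_coeff (\<lambda>z. c * f z) k = c * taylor_coeff f k"
  using higher_deriv_cmult[of f "ball 0 1" 0 k c]
  by (simp add: taylor_coeff_def fps_expansion_def)

instantiation hardy :: real_vector
begin

definition "0 = Abs_hardy (\<lambda>_. 0)"
definition "f + g = Abs_hardy (\<lambda>z. hardy_fun f z + hardy_fun g z)"
definition "- f = Abs_hardy (\<lambda>z. - hardy_fun f z)" for f :: hardy
definition "f - g = f + (- g)" for f g :: hardy
definition "r *\<^sub>R f = Abs_hardy (\<lambda>z. of_real r * hardy_fun f z)" for f :: hardy

lemma hardy_fun_zero: "hardy_fun 0 = (\<lambda>_. 0)"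
  unfolding zero_hardy_def
  by (subst Abs_hardy_inverse) (auto simp: taylor_coeff_def fps_expansion_def)

lemma hardy_fun_add: "hardy_fun (f + g) = (\<lambda>z. hardy_fun f z + hardy_fun g z)"
  unfolding plus_hardy_def
  by (subst Abs_hardy_inverse)
     (auto simp: taylor_coeff_add hardy_fun_holomorphic hardy_fun_outside
       hardy_coeff_def[symmetric] intro!: holomorphic_intros summable_square_add summable_hardy_coeff)

lemma Abs_hardy_cmult_inverse:
  "hardy_fun (Abs_hardy (\<lambda>z. c * hardy_fun f z)) = (\<lambda>z. c * hardy_fun f z)"
proof (rule Abs_hardy_inverse)
  show "(\<lambda>z. c * hardy_fun f z) \<in> {f. f holomorphic_on ball 0 1 \<and>
      summable (\<lambda>k. (cmod (taylor_coeff f k))\<^sup>2) \<and> (\<forall>z. z \<notin> ball 0 1 \<longrightarrow> f z = 0)}"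
    using summable_square_cmult[OF summable_hardy_coeff, of c f]
    by (auto simp: taylor_coeff_cmult hardy_fun_holomorphic hardy_fun_outside
      hardy_coeff_def intro!: holomorphic_intros)
qed

lemma hardy_fun_uminus: "hardy_fun (- f) = (\<lambda>z. - hardy_fun f z)"
  unfolding uminus_hardy_def using Abs_hardy_cmult_inverse[of "-1" f] by simp

lemma hardy_fun_scaleR: "hardy_fun (r *\<^sub>R f) = (\<lambda>z. of_real r * hardy_fun f z)"
  unfolding scaleR_hardy_def by (rule Abs_hardy_cmult_inverse)

instance
  by standard
     (auto simp: hardy_fun_inject[symmetric] minus_hardy_def hardy_fun_zero hardy_fun_add
       hardy_fun_uminus hardy_fun_scaleR algebra_simps)

end

definition hardy_scaleC :: "complex \<Rightarrow> hardy \<Rightarrow> hardy"  (infixr "*\<^sub>H" 75) where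
  "c *\<^sub>H f = Abs_hardy (\<lambda>z. c * hardy_fun f z)"

lemma hardy_fun_scaleC: "hardy_fun (c *\<^sub>H f) = (\<lambda>z. c * hardy_fun f z)"
  unfolding hardy_scaleC_def by (rule Abs_hardy_cmult_inverse)

interpretation hardy: vector_space hardy_scaleC
  by standard
     (auto simp: hardy_fun_inject[symmetric] hardy_fun_add hardy_fun_scaleC algebra_simps)

lemma hardy_coeff_zero: "hardy_coeff 0 k = 0"
  by (simp add: hardy_coeff_def hardy_fun_zero taylor_coeff_def fps_expansion_def)

lemma hardy_coeff_add: "hardy_coeff (f + g) k = hardy_coeff f k + hardy_coeff g k"
  by (simp add: hardy_coeff_def hardy_fun_add taylor_coeff_add hardy_fun_holomorphic)

lemma hardy_coeff_scaleC: "hardy_coeff (c *\<^sub>H f) k = c * hardy_coeff f k"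
  by (simp add: hardy_coeff_def hardy_fun_scaleC taylor_coeff_cmult hardy_fun_holomorphic)

lemma hardy_coeff_scaleR: "hardy_coeff (r *\<^sub>R f) k = r *\<^sub>R hardy_coeff f k"
  by (simp add: hardy_coeff_def hardy_fun_scaleR taylor_coeff_cmult hardy_fun_holomorphic
    scaleR_conv_of_real)

lemma summable_hardy_inner: "summable (\<lambda>k. hardy_coeff f k \<bullet> hardy_coeff g k)"
proof (rule summable_comparison_test')
  show "summable (\<lambda>k. (cmod (hardy_coeff f k))\<^sup>2 + (cmod (hardy_coeff g k))\<^sup>2)"
    by (intro summable_add summable_hardy_coeff)
  fix k :: nat
  let ?a = "cmod (hardy_coeff f k)" and ?b = "cmod (hardy_coeff g k)"
  have "\<bar>hardy_coeff f k \<bullet> hardy_coeff g k\<bar> \<le> ?a * ?b"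
    by (rule Cauchy_Schwarz_ineq2)
  also have "\<dots> \<le> ?a\<^sup>2 + ?b\<^sup>2"
    using sum_squares_bound[of ?a ?b] mult_nonneg_nonneg[of ?a ?b] by (simp del: mult_nonneg_nonneg)
  finally show "norm (hardy_coeff f k \<bullet> hardy_coeff g k) \<le> ?a\<^sup>2 + ?b\<^sup>2"
    by simp
qed

text \<open>The real inner product below is the real part of
  \<open>\<Sum>k. hardy_coeff f k * cnj (hardy_coeff g k)\<close>; the norm is the \<open>\<ell>\<^sup>2\<close> norm of the Taylor
  coefficients (lemma \<open>norm_hardy\<close>).\<close>

instantiation hardy :: real_inner
begin

definition "inner f g = (\<Sum>k. hardy_coeff f k \<bullet> hardy_coeff g k)"
definition "norm f = sqrt (inner f f)" for f :: hardy
definition "sgn f = f /\<^sub>R norm f" for f :: hardy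
definition "dist f g = norm (f - g)" for f g :: hardy
definition "uniformity = (INF e\<in>{0<..}. principal {(f, g :: hardy). dist f g < e})"
definition "open U = (\<forall>f\<in>U. eventually (\<lambda>(f', g). f' = f \<longrightarrow> g \<in> U) uniformity)" for U :: "hardy set"

instance
proof
  fix f g h :: hardy and r :: real
  show "inner f g = inner g f"
    by (simp add: inner_hardy_def inner_commute)
  show "inner (f + g) h = inner f h + inner g h"
    by (simp add: inner_hardy_def hardy_coeff_add inner_add_left suminf_add summable_hardy_inner)
  show "inner (r *\<^sub>R f) g = r * inner f g"
    by (simp add: inner_hardy_def hardy_coeff_scaleR suminf_mult summable_hardy_inner)
  show "0 \<le> inner f f"
    by (simp add: inner_hardy_def suminf_nonneg summable_hardy_inner)
  show "inner f f = 0 \<longleftrightarrow> f = 0"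
  proof
    assume "inner f f = 0"
    then have "hardy_coeff f k = 0" for k
      using suminf_eq_zero_iff[OF summable_hardy_inner[of f f]] by (simp add: inner_hardy_def)
    then show "f = 0"
      by (intro hardy_eqI) (simp add: hardy_coeff_zero)
  qed (simp add: inner_hardy_def hardy_coeff_zero)
qed (simp_all add: norm_hardy_def sgn_hardy_def dist_hardy_def uniformity_hardy_def open_hardy_def)

end

lemma norm_hardy: "norm f = sqrt (\<Sum>k. (cmod (hardy_coeff f k))\<^sup>2)"
  by (simp add: norm_hardy_def inner_hardy_def power2_norm_eq_inner)


section \<open>The weighted composition operators\<close>

text \<open>Meaningful for \<open>0 < x \<le> \<infinity>\<close> only; there the function under \<^term>\<open>Abs_hardy\<close> lies in the
  Hardy space (lemma \<open>hardy_fun_weighted_comp\<close>).\<close>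

definition exp_minus :: "ereal \<Rightarrow> real" where
  "exp_minus x = (if x = \<infinity> then 0 else exp (- real_of_ereal x))"

definition weighted_comp :: "ereal \<Rightarrow> hardy \<Rightarrow> hardy" where
  "weighted_comp x f = Abs_hardy (\<lambda>z::complex. if z \<in> ball 0 1
     then hardy_fun f (exp_minus x * z) / (1 - exp_minus x * z) else 0)"

lemma exp_minus_bounds:
  assumes "0 < x"
  shows "0 \<le> exp_minus x" "exp_minus x < 1"
  using assms by (cases x; simp add: exp_minus_def)+

lemma Abs_hardy_inverse_larger_disc:
  assumes hol: "g holomorphic_on ball 0 \<rho>" and \<rho>: "\<rho> > 1"
  shows "hardy_fun (Abs_hardy (\<lambda>z. if z \<in> ball 0 1 then g z else 0)) =
    (\<lambda>z. if z \<in> ball 0 1 then g z else 0)"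
proof (rule Abs_hardy_inverse)
  let ?g = "\<lambda>z. if z \<in> ball 0 1 then g z else 0"
  have "g holomorphic_on ball 0 1"
    by (rule holomorphic_on_subset[OF hol]) (use \<rho> in auto)
  then have hol': "?g holomorphic_on ball 0 1"
    by (rule holomorphic_transform) auto
  have "\<forall>\<^sub>F w in nhds 0. ?g w = g w"
    using eventually_nhds_in_open[of "ball 0 1" "0::complex"] by (auto elim: eventually_mono)
  then have coeff: "taylor_coeff ?g k = taylor_coeff g k" for k
    using fps_expansion_cong[of ?g g 0] by (simp add: taylor_coeff_def)
  obtain s where s: "1 < s" "s < \<rho>"
    using dense[OF \<rho>] by blast
  have "summable (\<lambda>k. taylor_coeff g k * complex_of_real s ^ k)"
    using taylor_coeff_sums[OF hol, of "of_real s"] s by (auto simp: sums_iff)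
  then have summ: "summable (\<lambda>k. cmod (taylor_coeff g k))"
    using powser_insidea[of "taylor_coeff g" "of_real s" 1] s by simp
  have "(\<lambda>k. cmod (taylor_coeff g k)) \<longlonglongrightarrow> 0"
    using summable_LIMSEQ_zero[OF summ] .
  then have "\<forall>\<^sub>F k in sequentially. cmod (taylor_coeff g k) < 1"
    by (rule order_tendstoD) simp
  then have "\<forall>\<^sub>F k in sequentially. norm ((cmod (taylor_coeff g k))\<^sup>2) \<le> cmod (taylor_coeff g k)"
    by eventually_elim (simp add: power2_eq_square mult_left_le)
  then have "summable (\<lambda>k. (cmod (taylor_coeff g k))\<^sup>2)"
    using summ by (rule summable_comparison_test_ev)
  with hol' coeff show "?g \<in> {f. f holomorphic_on ball 0 1 \<and>
      summable (\<lambda>k. (cmod (taylor_coeff f k))\<^sup>2) \<and> (\<forall>z. z \<notin> ball 0 1 \<longrightarrow> f z = 0)}"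
    by simp
qed

lemma hardy_fun_weighted_comp:
  fixes z :: complex
  assumes x: "0 < x" and z: "z \<in> ball 0 1"
  shows "hardy_fun (weighted_comp x f) z =
    hardy_fun f (exp_minus x * z) / (1 - exp_minus x * z)"
proof -
  define r where "r = exp_minus x"
  have r: "0 \<le> r" "r < 1"
    using exp_minus_bounds[OF x] by (simp_all add: r_def)
  define \<rho> where "\<rho> = 2 / (1 + r)"
  have \<rho>: "\<rho> > 1"
    using r by (simp add: \<rho>_def)
  have "r * \<rho> < 1"
    using r by (simp add: \<rho>_def field_simps)
  have in_disc: "cmod (of_real r * w) < 1" if "w \<in> ball 0 \<rho>" for w
  proof -
    have "cmod (of_real r * w) \<le> r * \<rho>"
      using that r by (simp add: norm_mult mult_left_mono)
    then show ?thesis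
      using \<open>r * \<rho> < 1\<close> by linarith
  qed
  have "(hardy_fun f \<circ> (\<lambda>w. of_real r * w)) holomorphic_on ball 0 \<rho>"
    by (rule holomorphic_on_compose_gen[OF _ hardy_fun_holomorphic])
       (auto intro!: holomorphic_intros in_disc)
  moreover have "1 - of_real r * w \<noteq> 0" if "w \<in> ball 0 \<rho>" for w :: complex
    using in_disc[OF that] by auto
  ultimately have "(\<lambda>w. hardy_fun f (of_real r * w) / (1 - of_real r * w)) holomorphic_on ball 0 \<rho>"
    by (intro holomorphic_intros) (auto simp: o_def)
  from Abs_hardy_inverse_larger_disc[OF this \<rho>] z show ?thesis
    unfolding weighted_comp_def r_def by simp
qed


section \<open>The Rhaly operator\<close>

definition moment :: "real measure \<Rightarrow> nat \<Rightarrow> real" where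
  "moment \<mu> n = (\<integral>t. t ^ n \<partial>\<mu>)"

definition rhaly_matrix :: "real measure \<Rightarrow> nat \<Rightarrow> nat \<Rightarrow> complex" where
  "rhaly_matrix \<mu> n k = (if k \<le> n then complex_of_real (moment \<mu> n) else 0)"

text \<open>The matrix of an operator with respect to the basis of monomials.\<close>

definition has_matrix :: "(hardy \<Rightarrow> hardy) \<Rightarrow> (nat \<Rightarrow> nat \<Rightarrow> complex) \<Rightarrow> bool" where
  "has_matrix T A \<longleftrightarrow> (\<forall>f n. (\<lambda>k. A n k * hardy_coeff f k) sums hardy_coeff (T f) n)"

text \<open>Boundedness of the matrix on the Hardy space is part of the predicate: the matrix
  determines at most one map, which exists only if every image sequence is square-summable.
  Complex homogeneity follows from the matrix representation.\<close>

definition bounded_rhaly_operator :: "real measure \<Rightarrow> (hardy \<Rightarrow> hardy) \<Rightarrow> bool" where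
  "bounded_rhaly_operator \<mu> R \<longleftrightarrow> bounded_linear R \<and> has_matrix R (rhaly_matrix \<mu>)"


definition invariant_under :: "hardy set \<Rightarrow> (hardy \<Rightarrow> hardy) \<Rightarrow> bool" where
  "invariant_under M T \<longleftrightarrow> T ` M \<subseteq> M"

end

theory Submission
  imports Defs
begin

text \<open>With \<open>t = e\<^sup>-\<^sup>x\<close> and \<open>s\<^sub>n\<close> the \<open>n\<close>-th partial sum of the Taylor coefficients of \<open>f\<close>, the \<open>n\<close>-th
  coefficient of \<open>W\<^sub>x f\<close> is \<open>t\<^sup>n s\<^sub>n\<close>, while that of \<open>R f\<close> is \<open>\<mu>\<^sub>n s\<^sub>n\<close>. Hence \<open>R f\<close> is formally the integral
  of \<open>W\<^sub>x f\<close> against \<open>\<mu>\<close>. Its lower Riemann sums over uniform grids lie in \<open>M\<close>. Sampling at the left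
  endpoints makes each coefficient of a Riemann sum at most that of \<open>R f\<close> in modulus, so coefficientwise
  convergence is dominated by the square-summable sequence of \<open>R f\<close> and the Riemann sums converge to
  \<open>R f\<close> in norm, although the operators \<open>W\<^sub>x\<close> need not be uniformly bounded as \<open>t\<close> tends to 1.\<close>

section \<open>Taylor coefficients of the weighted composition operators\<close>

lemma hardy_coeff_unique:
  assumes "\<And>z. cmod z < 1 \<Longrightarrow> (\<lambda>k. a k * z ^ k) sums hardy_fun f z"
  shows "hardy_coeff f = a"
proof -
  have disc: "\<forall>\<^sub>F z::complex in nhds 0. cmod z < 1"
    using eventually_nhds_in_open[of "ball 0 1" "0::complex"] by (auto elim: eventually_mono)
  have "hardy_fun f has_fps_expansion Abs_fps a"
    by (rule has_fps_expansionI, rule eventually_mono[OF disc]) (simp add: assms)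
  moreover have "hardy_fun f has_fps_expansion Abs_fps (hardy_coeff f)"
    by (rule has_fps_expansionI, rule eventually_mono[OF disc]) (simp add: hardy_fun_sums)
  ultimately have "Abs_fps (hardy_coeff f) = Abs_fps a"
    by (metis fps_expansion_unique_complex)
  then show ?thesis
    by (metis fps_nth_Abs_fps ext)
qed

text \<open>With \<open>r = exp_minus x\<close>, the image is the product of the power series of
  \<open>f\<close> at \<open>r * z\<close> and the geometric series of
  \<open>1 / (1 - r * z)\<close>. In the Cauchy product every term of index \<open>n\<close> carries
  the same power \<open>(r * z) ^ n\<close>, which leaves the partial sum of the
  coefficients.\<close>

lemma hardy_coeff_weighted_comp:
  assumes "0 < x"
  shows "hardy_coeff (weighted_comp x f) n =
    of_real (exp_minus x) ^ n * (\<Sum>k\<le>n. hardy_coeff f k)"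
proof -
  define r where "r = complex_of_real (exp_minus x)"
  have "(\<lambda>n. (r ^ n * (\<Sum>k\<le>n. hardy_coeff f k)) * z ^ n) sums hardy_fun (weighted_comp x f) z"
    if z: "cmod z < 1" for z
  proof -
    have rz: "cmod (r * z) < 1"
      using mult_left_le_one_le[of "cmod z" "exp_minus x"] z exp_minus_bounds[OF assms]
      unfolding r_def norm_mult by simp
    \<comment> \<open>The Cauchy product needs absolute convergence at \<open>r * z\<close>. It
      follows from plain convergence at the point \<open>c\<close>, which is farther from 0 but
      still in the disc.\<close>
    obtain c where c: "cmod (r * z) < c" "c < 1"
      using dense[OF rz] by blast
    have "summable (\<lambda>k. hardy_coeff f k * of_real c ^ k)"
      using hardy_fun_sums[of "of_real c" f] c norm_ge_zero[of "r * z"] by (auto simp: sums_iff)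
    then have summ: "summable (\<lambda>k. norm (hardy_coeff f k * (r * z) ^ k))"
      by (rule powser_insidea) (use c in auto)
    have "(\<lambda>n. \<Sum>k\<le>n. (hardy_coeff f k * (r * z) ^ k) * (r * z) ^ (n - k)) sums
        ((\<Sum>k. hardy_coeff f k * (r * z) ^ k) * (\<Sum>k. (r * z) ^ k))"
      by (rule Cauchy_product_sums[OF summ]) (use rz in \<open>simp add: norm_power summable_geometric\<close>)
    also have "(\<Sum>k. hardy_coeff f k * (r * z) ^ k) = hardy_fun f (r * z)"
      using hardy_fun_sums[OF rz] by (simp add: sums_iff)
    also have "(\<Sum>k. (r * z) ^ k) = 1 / (1 - r * z)"
      using suminf_geometric[OF rz] .
    also have "(\<lambda>n. \<Sum>k\<le>n. (hardy_coeff f k * (r * z) ^ k) * (r * z) ^ (n - k)) =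
        (\<lambda>n. (r ^ n * (\<Sum>k\<le>n. hardy_coeff f k)) * z ^ n)"
    proof
      fix n
      have "(\<Sum>k\<le>n. (hardy_coeff f k * (r * z) ^ k) * (r * z) ^ (n - k)) =
          (\<Sum>k\<le>n. hardy_coeff f k * (r * z) ^ n)"
        by (intro sum.cong) (simp_all add: mult.assoc flip: power_add)
      then show "(\<Sum>k\<le>n. (hardy_coeff f k * (r * z) ^ k) * (r * z) ^ (n - k)) =
          (r ^ n * (\<Sum>k\<le>n. hardy_coeff f k)) * z ^ n"
        by (simp add: power_mult_distrib mult_ac flip: sum_distrib_right)
    qed
    finally show ?thesis
      using hardy_fun_weighted_comp[OF assms, of z f] z by (simp add: r_def)
  qed
  from hardy_coeff_unique[OF this] show ?thesis
    by (simp add: r_def)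
qed

section \<open>Dominated convergence in the Hardy norm\<close>

lemma hardy_coeff_sum: "hardy_coeff (\<Sum>i\<in>A. g i) n = (\<Sum>i\<in>A. hardy_coeff (g i) n)"
  by (induction A rule: infinite_finite_induct) (simp_all add: hardy_coeff_zero hardy_coeff_add)

lemma hardy_coeff_diff: "hardy_coeff (f - g) n = hardy_coeff f n - hardy_coeff g n"
  using hardy_coeff_add[of "f - g" g n] by simp

text \<open>The squared norm of \<open>g N - h\<close> is a series whose terms tend to 0 and are
  bounded, uniformly in \<open>N\<close>, by the summable sequence of 4 times the squared moduli of
  the coefficients of \<open>h\<close>. Tannery's theorem lets the limit pass under the sum.\<close>

lemma tendsto_hardy_dominated:
  assumes lim: "\<And>n. (\<lambda>N. hardy_coeff (g N) n) \<longlonglongrightarrow> hardy_coeff h n"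
    and bound: "\<And>N n. cmod (hardy_coeff (g N) n) \<le> cmod (hardy_coeff h n)"
  shows "g \<longlonglongrightarrow> h"
proof -
  have bd: "norm ((cmod (hardy_coeff (g N - h) n))\<^sup>2) \<le> 4 * (cmod (hardy_coeff h n))\<^sup>2" for N n
  proof -
    have "cmod (hardy_coeff (g N - h) n) \<le> 2 * cmod (hardy_coeff h n)"
      using norm_triangle_ineq4[of "hardy_coeff (g N) n" "hardy_coeff h n"] bound[of N n]
      by (simp add: hardy_coeff_diff)
    then show ?thesis
      using power_mono[of "cmod (hardy_coeff (g N - h) n)" "2 * cmod (hardy_coeff h n)" 2]
      by (simp add: power_mult_distrib)
  qed
  have "(\<lambda>N. (cmod (hardy_coeff (g N - h) n))\<^sup>2) \<longlonglongrightarrow> 0" for n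
    unfolding hardy_coeff_diff using lim[of n]
    by (auto intro!: tendsto_eq_intros LIM_zero simp: tendsto_norm_zero_iff)
  moreover have "\<forall>\<^sub>F (n, N) in sequentially \<times>\<^sub>F sequentially.
      norm ((cmod (hardy_coeff (g N - h) n))\<^sup>2) \<le> 4 * (cmod (hardy_coeff h n))\<^sup>2"
    by (intro always_eventually) (use bd in auto)
  moreover have "summable (\<lambda>n. 4 * (cmod (hardy_coeff h n))\<^sup>2)"
    by (intro summable_mult summable_hardy_coeff)
  ultimately have "(\<lambda>N. \<Sum>n. (cmod (hardy_coeff (g N - h) n))\<^sup>2) \<longlonglongrightarrow> (\<Sum>n. 0)"
    by (rule tannerys_theorem[THEN conjunct2, THEN conjunct2]) simp
  then have "(\<lambda>N. \<Sum>n. (cmod (hardy_coeff (g N - h) n))\<^sup>2) \<longlonglongrightarrow> 0"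
    by simp
  from tendsto_real_sqrt[OF this] have "(\<lambda>N. norm (g N - h)) \<longlonglongrightarrow> 0"
    by (simp add: norm_hardy)
  then show ?thesis
    by (rule LIM_zero_cancel[OF tendsto_norm_zero_cancel])
qed

section \<open>Lower Riemann sums of the moments\<close>

lemma floor_divide_bounds:
  fixes m t :: real
  assumes "0 < m"
  shows "t - 1 / m \<le> real_of_int \<lfloor>m * t\<rfloor> / m" "real_of_int \<lfloor>m * t\<rfloor> / m \<le> t"
proof -
  have "(m * t - 1) / m \<le> real_of_int \<lfloor>m * t\<rfloor> / m" "real_of_int \<lfloor>m * t\<rfloor> / m \<le> m * t / m"
    by (rule divide_right_mono; use assms in linarith)+
  then show "t - 1 / m \<le> real_of_int \<lfloor>m * t\<rfloor> / m" "real_of_int \<lfloor>m * t\<rfloor> / m \<le> t"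
    using assms by (simp_all add: diff_divide_distrib)
qed

lemma floor_divide_tendsto:
  fixes t :: real
  shows "(\<lambda>N. real_of_int \<lfloor>real (Suc N) * t\<rfloor> / real (Suc N)) \<longlonglongrightarrow> t"
proof (rule tendsto_sandwich)
  have "(\<lambda>N. t - 1 / real (Suc N)) \<longlonglongrightarrow> t - 0"
    by (intro tendsto_intros lim_const_over_n[THEN LIMSEQ_Suc])
  then show "(\<lambda>N. t - 1 / real (Suc N)) \<longlonglongrightarrow> t"
    by simp
  show "\<forall>\<^sub>F N in sequentially. t - 1 / real (Suc N) \<le> real_of_int \<lfloor>real (Suc N) * t\<rfloor> / real (Suc N)"
    "\<forall>\<^sub>F N in sequentially. real_of_int \<lfloor>real (Suc N) * t\<rfloor> / real (Suc N) \<le> t"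
    by (intro always_eventually allI floor_divide_bounds of_nat_0_less_iff[THEN iffD2] zero_less_Suc)+
qed (rule tendsto_const)

text \<open>On [0,1) this is the interval from \<open>j / (N + 1)\<close> to
  \<open>(j + 1) / (N + 1)\<close>, closed on the left. The floor form makes the Riemann sum the
  integral of a single floor expression. Using \<open>Suc N\<close> avoids division by 0.\<close>

definition grid_cell :: "real measure \<Rightarrow> nat \<Rightarrow> nat \<Rightarrow> real set" where
  "grid_cell \<mu> N j = {t \<in> space \<mu>. \<lfloor>real (Suc N) * t\<rfloor> = int j}"

text \<open>Each cell is sampled at its left endpoint. Since \<open>0 ^ 0 = 1\<close>, the cell at 0
  contributes its full mass when \<open>n = 0\<close>.\<close>

definition moment_approx :: "real measure \<Rightarrow> nat \<Rightarrow> nat \<Rightarrow> real" where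
  "moment_approx \<mu> N n =
    (\<Sum>j\<le>N. measure \<mu> (grid_cell \<mu> N j) * (real j / real (Suc N)) ^ n)"

context
  fixes \<mu> :: "real measure"
  assumes finite: "finite_measure \<mu>"
    and sets_unit: "sets \<mu> = sets (restrict_space borel {0..<1})"
begin

interpretation finite_measure \<mu>
  by (fact finite)

lemma space_unit: "space \<mu> = {0..<1}"
  using sets_eq_imp_space_eq[OF sets_unit] by (simp add: space_restrict_space)

lemma measurable_unit: "f \<in> borel_measurable borel \<Longrightarrow> f \<in> borel_measurable \<mu>"
  for f :: "real \<Rightarrow> real"
  unfolding measurable_cong_sets[OF sets_unit refl] by (rule measurable_restrict_space1)

lemma sets_grid_cell: "grid_cell \<mu> N j \<in> sets \<mu>"
proof -
  have "(\<lambda>t. real_of_int \<lfloor>real (Suc N) * t\<rfloor>) \<in> borel_measurable \<mu>"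
    by (rule measurable_unit) measurable
  then have "{t \<in> space \<mu>. real_of_int \<lfloor>real (Suc N) * t\<rfloor> = real j} \<in> sets \<mu>"
    by measurable
  also have "{t \<in> space \<mu>. real_of_int \<lfloor>real (Suc N) * t\<rfloor> = real j} = grid_cell \<mu> N j"
    by (auto simp: grid_cell_def)
  finally show ?thesis .
qed

lemma integrable_power: "integrable \<mu> (\<lambda>t. t ^ n)"
  by (rule integrable_const_bound[where B = 1])
     (auto simp: space_unit power_le_one measurable_unit)

text \<open>The cells with \<open>j \<le> N\<close> partition [0,1), and on each of them the floor
  quotient is constantly \<open>j / (N + 1)\<close>. Convergence and comparison with the moments
  thus reduce to statements about integrands.\<close>

lemma moment_approx_eq_integral:
  "moment_approx \<mu> N n = (\<integral>t. (real_of_int \<lfloor>real (Suc N) * t\<rfloor> / real (Suc N)) ^ n \<partial>\<mu>)"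
proof -
  have "moment_approx \<mu> N n =
      (\<Sum>j\<le>N. \<integral>t. indicator (grid_cell \<mu> N j) t * (real j / real (Suc N)) ^ n \<partial>\<mu>)"
    by (simp add: moment_approx_def sets_grid_cell sets.sets_into_space Int_absorb1)
  also have "\<dots> = (\<integral>t. (\<Sum>j\<le>N. indicator (grid_cell \<mu> N j) t * (real j / real (Suc N)) ^ n) \<partial>\<mu>)"
    by (rule Bochner_Integration.integral_sum[symmetric])
       (auto simp: sets_grid_cell less_top[symmetric] emeasure_finite)
  also have "\<dots> = (\<integral>t. (real_of_int \<lfloor>real (Suc N) * t\<rfloor> / real (Suc N)) ^ n \<partial>\<mu>)"
  proof (rule Bochner_Integration.integral_cong[OF refl])
    fix t assume t: "t \<in> space \<mu>"
    define i where "i = nat \<lfloor>real (Suc N) * t\<rfloor>"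
    \<comment> \<open>The strict bound, from \<open>t < 1\<close>, keeps the index of the cell of
      \<open>t\<close> at most \<open>N\<close>.\<close>
    have "real (Suc N) * t < real (Suc N)" "0 \<le> real (Suc N) * t"
      using t by (auto simp: space_unit)
    then have i: "\<lfloor>real (Suc N) * t\<rfloor> = int i" "i \<le> N"
      unfolding i_def by linarith+
    have "(\<Sum>j\<le>N. indicator (grid_cell \<mu> N j) t * (real j / real (Suc N)) ^ n) =
        (\<Sum>j\<le>N. if i = j then (real j / real (Suc N)) ^ n else 0)"
      using t i by (intro sum.cong) (auto simp: grid_cell_def indicator_def)
    also have "\<dots> = (real i / real (Suc N)) ^ n"
      using i by simp
    finally show "(\<Sum>j\<le>N. indicator (grid_cell \<mu> N j) t * (real j / real (Suc N)) ^ n) =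
        (real_of_int \<lfloor>real (Suc N) * t\<rfloor> / real (Suc N)) ^ n"
      using i by simp
  qed
  finally show ?thesis .
qed

text \<open>Rounding down does not increase \<open>t\<close> and keeps it nonnegative, so taking
  powers preserves the order. This supplies both the dominating function for the limit and the
  comparison with the moments.\<close>

lemma floor_grid_bounds:
  assumes "t \<in> space \<mu>"
  shows "0 \<le> (real_of_int \<lfloor>real (Suc N) * t\<rfloor> / real (Suc N)) ^ n"
    "(real_of_int \<lfloor>real (Suc N) * t\<rfloor> / real (Suc N)) ^ n \<le> t ^ n"
proof -
  have t: "0 \<le> real (Suc N) * t"
    using assms by (simp add: space_unit)
  then have nonneg: "0 \<le> real_of_int \<lfloor>real (Suc N) * t\<rfloor> / real (Suc N)"
    by simp
  then show "0 \<le> (real_of_int \<lfloor>real (Suc N) * t\<rfloor> / real (Suc N)) ^ n"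
    by simp
  have "real_of_int \<lfloor>real (Suc N) * t\<rfloor> / real (Suc N) \<le> t"
    by (intro floor_divide_bounds) simp
  with nonneg show "(real_of_int \<lfloor>real (Suc N) * t\<rfloor> / real (Suc N)) ^ n \<le> t ^ n"
    by (rule power_mono[rotated])
qed

lemma measurable_floor_grid:
  "(\<lambda>t. (real_of_int \<lfloor>real (Suc N) * t\<rfloor> / real (Suc N)) ^ n) \<in> borel_measurable \<mu>"
  by (rule measurable_unit) (simp del: of_nat_Suc)

lemma moment_approx_tendsto: "(\<lambda>N. moment_approx \<mu> N n) \<longlonglongrightarrow> moment \<mu> n"
  unfolding moment_approx_eq_integral moment_def
proof (rule integral_dominated_convergence[where w = "\<lambda>t. t ^ n"])
  show "AE t in \<mu>. (\<lambda>N. (real_of_int \<lfloor>real (Suc N) * t\<rfloor> / real (Suc N)) ^ n) \<longlonglongrightarrow> t ^ n"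
    by (intro AE_I2 tendsto_power floor_divide_tendsto)
  show "AE t in \<mu>. norm ((real_of_int \<lfloor>real (Suc N) * t\<rfloor> / real (Suc N)) ^ n) \<le> t ^ n" for N
  proof (rule AE_I2)
    fix t assume "t \<in> space \<mu>"
    from floor_grid_bounds[OF this, where N = N and n = n]
    show "norm ((real_of_int \<lfloor>real (Suc N) * t\<rfloor> / real (Suc N)) ^ n) \<le> t ^ n"
      unfolding real_norm_def by linarith
  qed
  show "(\<lambda>t. t ^ n) \<in> borel_measurable \<mu>"
    by (rule borel_measurable_integrable[OF integrable_power])
qed (rule measurable_floor_grid integrable_power)+

lemma moment_approx_nonneg: "0 \<le> moment_approx \<mu> N n"
  unfolding moment_approx_eq_integral
  by (rule Bochner_Integration.integral_nonneg) (rule floor_grid_bounds(1))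

lemma moment_approx_le: "moment_approx \<mu> N n \<le> moment \<mu> n"
  unfolding moment_approx_eq_integral moment_def
proof (rule integral_mono_AE)
  show "integrable \<mu> (\<lambda>t. (real_of_int \<lfloor>real (Suc N) * t\<rfloor> / real (Suc N)) ^ n)"
    by (rule Bochner_Integration.integrable_bound[OF integrable_power[of n] measurable_floor_grid], rule AE_I2)
       (use floor_grid_bounds[where N = N and n = n] in \<open>fastforce simp del: of_nat_Suc\<close>)
  show "AE t in \<mu>. (real_of_int \<lfloor>real (Suc N) * t\<rfloor> / real (Suc N)) ^ n \<le> t ^ n"
    by (rule AE_I2) (rule floor_grid_bounds(2))
qed (rule integrable_power)

end

section \<open>Approximation of the Rhaly operator inside the subspace\<close>

lemma exists_exp_minus_eq:
  assumes "0 \<le> r" "r < 1"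
  shows "\<exists>x>0. exp_minus x = r"
proof (cases "r = 0")
  case True
  then show ?thesis
    by (intro exI[of _ \<infinity>]) (simp add: exp_minus_def)
next
  case False
  then show ?thesis
    using assms by (intro exI[of _ "ereal (- ln r)"]) (simp add: exp_minus_def)
qed

theorem proposition3p3:
  fixes \<mu> :: "real measure" and R :: "hardy \<Rightarrow> hardy" and M :: "hardy set"
  assumes "finite_measure \<mu>" and "sets \<mu> = sets (restrict_space borel {0..<1})"
    and "bounded_rhaly_operator \<mu> R"
    and "hardy.subspace M" and "closed M"
    and "\<And>x. 0 < x \<Longrightarrow> invariant_under M (weighted_comp x)"
  shows "invariant_under M R"
  unfolding invariant_under_def
proof (rule image_subsetI)
  fix f assume f: "f \<in> M"
  \<comment> \<open>Every node \<open>j / (N + 1)\<close> with \<open>j \<le> N\<close> lies in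
    [0,1), hence comes from an admissible parameter; the node 0 comes from
    \<open>x = \<infinity>\<close>.\<close>
  have "\<exists>x>0. exp_minus x = real j / real (Suc N)" if "j \<le> N" for j N
    using that by (intro exists_exp_minus_eq) (simp_all add: field_simps)
  then obtain x where x: "\<And>j N. j \<le> N \<Longrightarrow> 0 < x j N \<and> exp_minus (x j N) = real j / real (Suc N)"
    by metis
  define g where "g N = (\<Sum>j\<le>N. complex_of_real (measure \<mu> (grid_cell \<mu> N j)) *\<^sub>H
    weighted_comp (x j N) f)" for N
  have "weighted_comp (x j N) f \<in> M" if "j \<le> N" for j N
    using assms(6)[of "x j N"] x[OF that] f by (auto simp: invariant_under_def)
  then have g_in: "g N \<in> M" for N
    unfolding g_def by (intro hardy.subspace_sum hardy.subspace_scale assms(4)) simp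
  have coeff_g: "hardy_coeff (g N) n =
      complex_of_real (moment_approx \<mu> N n) * (\<Sum>k\<le>n. hardy_coeff f k)" for N n
    unfolding g_def hardy_coeff_sum moment_approx_def of_real_sum sum_distrib_right
    by (intro sum.cong) (use x in \<open>auto simp: hardy_coeff_scaleC hardy_coeff_weighted_comp\<close>)
  have coeff_R: "hardy_coeff (R f) n =
      complex_of_real (moment \<mu> n) * (\<Sum>k\<le>n. hardy_coeff f k)" for n
  proof -
    have "(\<lambda>k. rhaly_matrix \<mu> n k * hardy_coeff f k) sums hardy_coeff (R f) n"
      using assms(3) by (simp add: bounded_rhaly_operator_def has_matrix_def)
    \<comment> \<open>Row \<open>n\<close> of the matrix vanishes beyond the diagonal, so its series
      is a finite sum.\<close>
    moreover have "(\<lambda>k. rhaly_matrix \<mu> n k * hardy_coeff f k) sums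
        (\<Sum>k\<le>n. rhaly_matrix \<mu> n k * hardy_coeff f k)"
      by (rule sums_finite) (auto simp: rhaly_matrix_def)
    ultimately show ?thesis
      by (simp add: sums_iff rhaly_matrix_def sum_distrib_left)
  qed
  have "g \<longlonglongrightarrow> R f"
  proof (rule tendsto_hardy_dominated)
    show "(\<lambda>N. hardy_coeff (g N) n) \<longlonglongrightarrow> hardy_coeff (R f) n" for n
      unfolding coeff_g coeff_R
      by (intro tendsto_intros moment_approx_tendsto assms)
    \<comment> \<open>Both coefficients are the same partial sum times a nonnegative real factor, so
      it suffices to compare \<open>moment_approx\<close> with \<open>moment\<close>.\<close>
    show "cmod (hardy_coeff (g N) n) \<le> cmod (hardy_coeff (R f) n)" for N n
      using moment_approx_nonneg[OF assms(1,2), of N n] moment_approx_le[OF assms(1,2), of N n]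
      unfolding coeff_g coeff_R by (simp add: norm_mult mult_right_mono)
  qed
  with g_in assms(5) show "R f \<in> M"
    by (metis closed_sequentially)
qed

end
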